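(* Let $(a_k)_{k\in\mathbb{N}}$ be a sequence of positive integers satisfying the large gap condition $a_{k+1}/a_k\to\infty$ as $k\to\infty$. Let $U$ be uniformly distributed on $[0,1]$ and let $S_n=\sum_{k=1}^n\cos(2\pi a_kU)$, $n\in\mathbb{N}$. Then $(S_n/n)_{n\in\mathbb{N}}$ satisfies a large deviation principle with speed $n$ and rate function $\widetilde I$.
   Context: Large deviation principle (LDP): a sequence $(Z_n)_{n\in\mathbb N}$ of real random variables satisfies an LDP with speed $s_n\uparrow\infty$ and rate function $I:\mathbb R\to[0,\infty]$ if $I$ is lower semicontinuous and for every Borel set $A\subset\mathbb R$, $$-\inf_{x\in A^\circ}I(x)\le\liminf_{n\to\infty}\frac1{s_n}\log\mathbb P(Z_n\in A)\le\limsup_{n\to\infty}\frac1{s_n}\log\mathbb P(Z_n\in A)\le-\inf_{x\in\bar A}I(x),$$ where $A^\circ$ and $\bar A$ are the interior and closure of $A$. The function $\widetilde I$: let $\widetilde X_1=\cos(2\pi U)$ with $U$ uniform on $[0,1]$ (so $\widetilde X_1$ has the arcsine law on $(-1,1)$ with density $1/(\pi\sqrt{1-x^2})$), and for $\theta\in\mathbb R$ let $$\widetilde\Lambda(\theta)=\log\mathbb E[e^{\theta\widetilde X_1}]=\log\sum_{m=0}^\infty\frac{\theta^{2m}}{2^{2m}(m!)^2}.$$ Then $\widetilde I(x)=\sup_{\theta\in\mathbb R}[\theta x-\widetilde\Lambda(\theta)]$ for $x\in\mathbb R$. *)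

theory Defs
  imports "HOL-Probability.Probability"
begin

text \<open>The real \<open>ln\<close> has \<open>ln 0 = 0\<close>; large deviation bounds need \<open>log 0 = -\<infinity>\<close>.
  Only nonnegative arguments are relevant.\<close>

definition ext_log :: "real \<Rightarrow> ereal" where
  "ext_log p = (if p = 0 then -\<infinity> else ereal (ln p))"

definition lower_semicontinuous :: "('a::topological_space \<Rightarrow> ereal) \<Rightarrow> bool" where
  "lower_semicontinuous f \<longleftrightarrow> (\<forall>c. closed {x. f x \<le> c})"

text \<open>Infima are taken in \<^typ>\<open>ereal\<close>, so the infimum over the empty set is \<open>\<infinity>\<close>. The finitely many
  indices with \<open>s n \<le> 0\<close> do not affect the bounds.\<close>

definition (in prob_space) satisfies_LDP ::
  "(nat \<Rightarrow> 'a \<Rightarrow> real) \<Rightarrow> (nat \<Rightarrow> real) \<Rightarrow> (real \<Rightarrow> ereal) \<Rightarrow> bool" where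
  "satisfies_LDP Z s I \<longleftrightarrow>
     (\<forall>n. random_variable borel (Z n)) \<and>
     incseq s \<and> filterlim s at_top sequentially \<and>
     (\<forall>x. 0 \<le> I x) \<and> lower_semicontinuous I \<and>
     (\<forall>A \<in> sets borel.
        let L = (\<lambda>n. ereal (1 / s n) * ext_log (prob {\<omega> \<in> space M. Z n \<omega> \<in> A}))
        in - (INF x\<in>interior A. I x) \<le> liminf L \<and>
           liminf L \<le> limsup L \<and>
           limsup L \<le> - (INF x\<in>closure A. I x))"

text \<open>The logarithmic moment generating function of \<open>cos (2\<pi>U)\<close>, \<open>U\<close> uniform on \<open>[0,1]\<close>. The
  integrand is bounded and positive, so the integral exists and is positive.\<close>

definition tilde_Lambda :: "real \<Rightarrow> real" where
  "tilde_Lambda \<theta> = ln (\<integral>u. exp (\<theta> * cos (2 * pi * u)) \<partial>uniform_measure lborel {0..1::real})"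

definition tilde_I :: "real \<Rightarrow> ereal" where
  "tilde_I x = (SUP \<theta>::real. ereal (\<theta> * x - tilde_Lambda \<theta>))"

end

theory Submission
  imports Defs "HOL-Real_Asymp.Real_Asymp"
begin

text \<open>The product \<open>\<Prod>k\<le>n. exp (\<theta> * cos (2 * pi * a k * u))\<close> has logarithmic oscillation at most
  \<open>2 * pi * \<bar>\<theta>\<bar> * (\<Sum>k\<le>n. a k) / a (n + 1)\<close> on each period of \<open>cos (2 * pi * a (n + 1) * u)\<close>, which tends to
  \<open>0\<close> by the gap condition. Integrating period by period, the logarithmic moment generating function
  of \<open>S\<^sub>n\<close> grows by \<open>tilde_Lambda \<theta> + o(1)\<close> in each step, so \<open>S\<^sub>n\<close> has the same limiting scaled
  cumulant generating function as in the independent case. It is differentiable and its slopes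
  exhaust \<open>(-1, 1)\<close>, so the Gaertner--Ellis argument applies: Chernoff bounds on half-lines from
  above, exponential tilting from below.\<close>

subsection \<open>Averaging over a period\<close>

text \<open>Cesaro averaging: past some \<open>N\<close> each increment misses \<open>L\<close> by
  less than \<open>e / 2\<close>, so the errors add up to at most \<open>n * (e / 2)\<close>, and
  the fixed initial stretch disappears on division by \<open>n\<close>.\<close>

lemma tendsto_of_increments:
  fixes x :: "nat \<Rightarrow> real"
  assumes "(\<lambda>n. x (Suc n) - x n) \<longlonglongrightarrow> L"
  shows "(\<lambda>n. x n / real n) \<longlonglongrightarrow> L"
proof (rule LIMSEQ_I)
  fix e :: real assume "e > 0"
  then obtain N where N: "\<And>n. n \<ge> N \<Longrightarrow> \<bar>x (Suc n) - x n - L\<bar> < e / 2"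
    using LIMSEQ_D[OF assms, of "e / 2"] by auto
  have growth: "\<bar>x n - x N - real (n - N) * L\<bar> \<le> real (n - N) * (e / 2)" if "n \<ge> N" for n
    using that
  proof (induction n rule: dec_induct)
    case (step n)
    then have "real (Suc n - N) = real (n - N) + 1"
      by simp
    then show ?case
      using N[OF \<open>N \<le> n\<close>] step.IH by (simp only: abs_le_iff abs_less_iff distrib_right) linarith
  qed simp
  define C where "C = \<bar>x N\<bar> + real N * \<bar>L\<bar>"
  have "(\<lambda>n. C / real n) \<longlonglongrightarrow> 0"
    by (rule lim_const_over_n)
  then obtain N' where N': "\<And>n. n \<ge> N' \<Longrightarrow> \<bar>C / real n\<bar> < e / 2"
    using LIMSEQ_D[of "\<lambda>n. C / real n" 0 "e / 2"] \<open>e > 0\<close> by auto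
  have "norm (x n / real n - L) < e" if n: "n \<ge> max (Suc 0) (max N N')" for n
  proof -
    have pos: "real n > 0" and "n \<ge> N" and "n \<ge> N'" and nN: "real (n - N) = real n - real N" using n by auto
    have "\<bar>x n - real n * L\<bar> \<le> \<bar>x n - x N - real (n - N) * L\<bar> + \<bar>x N\<bar> + \<bar>real N * L\<bar>"
      unfolding nN by (simp add: algebra_simps)
    also have "\<dots> \<le> real n * (e / 2) + C"
    proof -
      have "real (n - N) * (e / 2) \<le> real n * (e / 2)"
        using \<open>e > 0\<close> by (intro mult_right_mono) auto
      then show ?thesis
        using growth[OF \<open>n \<ge> N\<close>] by (simp add: C_def abs_mult)
    qed
    finally have "\<bar>x n - real n * L\<bar> / real n \<le> e / 2 + C / real n"
      using pos by (simp add: field_simps)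
    moreover have "\<bar>x n - real n * L\<bar> / real n = \<bar>x n / real n - L\<bar>"
      using pos abs_divide[of "x n - real n * L" "real n"] by (simp add: diff_divide_distrib)
    ultimately show ?thesis
      using N'[OF \<open>n \<ge> N'\<close>] unfolding real_norm_def by linarith
  qed
  then show "\<exists>no. \<forall>n\<ge>no. norm (x n / real n - L) < e" by blast
qed

text \<open>The substitution \<open>v = N * u - i\<close> maps the block onto the unit interval, and
  the integer shift leaves \<open>f\<close> unchanged.\<close>

lemma integral_periodic_block:
  fixes f :: "real \<Rightarrow> real" and N i :: nat
  assumes cont: "continuous_on UNIV f" and per: "\<And>x. f (x + 1) = f x" and N: "N > 0"
  shows "integral {real i / N..real (Suc i) / N} (\<lambda>u. f (real N * u)) = integral {0..1} f / real N"
proof -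
  have shift: "f (x + real k) = f x" for x k
  proof (induction k)
    case (Suc k)
    then show ?case using per[of "x + real k"] by (simp add: add_ac)
  qed simp
  have "(f has_integral integral {0..1} f) (cbox 0 1)"
    using integrable_continuous_real[OF continuous_on_subset[OF cont]]
    by (simp add: integrable_integral)
  from has_integral_affinity'[OF this, of "real N" "- real i"]
  have "((\<lambda>u. f (real N * u - real i)) has_integral integral {0..1} f / real N)
      {real i / N..real (Suc i) / N}"
    using N by (simp add: divide_inverse mult.commute add.commute)
  moreover have "f (real N * u - real i) = f (real N * u)" for u
    using shift[of "real N * u - real i" i] by simp
  ultimately show ?thesis
    by (simp add: integral_unique)
qed

text \<open>On a block of length \<open>1 / N\<close> the slow factor \<open>h\<close> varies by a
  factor of at most \<open>exp (K / N)\<close>, while the fast factor completes one full period and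
  can be replaced by its mean. The oscillation of \<open>h\<close> is measured multiplicatively
  because logarithms of the integrals are compared later.\<close>

lemma integral_mult_periodic_bounds:
  fixes f h :: "real \<Rightarrow> real" and N :: nat
  assumes f: "continuous_on UNIV f" "\<And>x. f (x + 1) = f x" "\<And>x. f x \<ge> 0"
    and h: "continuous_on UNIV h" "\<And>u v. h u \<le> exp (K * \<bar>u - v\<bar>) * h v"  "\<And>x. h x \<ge> 0"
    and N: "N > 0" and K: "K \<ge> 0"
  shows "integral {0..1} (\<lambda>u. h u * f (real N * u))
           \<le> exp (K / N) * (integral {0..1} f * integral {0..1} h)"
    and "integral {0..1} f * integral {0..1} h
           \<le> exp (K / N) * integral {0..1} (\<lambda>u. h u * f (real N * u))"
proof -
  define g where "g u = f (real N * u)" for u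
  have contg: "continuous_on UNIV g"
    unfolding g_def by (intro continuous_on_compose2[OF f(1)] continuous_intros) auto
  have int: "p integrable_on {a..b}" if "continuous_on UNIV p" for p :: "real \<Rightarrow> real" and a b
    using that integrable_continuous_real continuous_on_subset by blast
  have conthg: "continuous_on UNIV (\<lambda>u. h u * g u)"
    by (intro continuous_intros h contg)
  have g0: "g u \<ge> 0" for u unfolding g_def by (rule f)
  define c where "c = exp (K / N)"
  define m where "m = integral {0..1} f"
  have m0: "m \<ge> 0"
    unfolding m_def by (intro integral_nonneg int f)
  define B where "B i = {real i / N..real (Suc i) / N}" for i
  have gB: "integral (B i) g = m / N" for i
    unfolding B_def g_def m_def by (rule integral_periodic_block[OF f(1,2) N])
  have osc: "h u \<le> c * h v" if "u \<in> B i" "v \<in> B i" for u v i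
  proof -
    have "\<bar>u - v\<bar> \<le> real (Suc i) / N - real i / N"
      using that unfolding B_def abs_le_iff atLeastAtMost_iff by linarith
    then have "\<bar>u - v\<bar> \<le> 1 / N"
      by (simp add: diff_divide_distrib[symmetric])
    then have "K * \<bar>u - v\<bar> \<le> K / N"
      using K mult_left_mono[of "\<bar>u - v\<bar>" "1 / N" K] by simp
    then have "exp (K * \<bar>u - v\<bar>) * h v \<le> c * h v"
      unfolding c_def by (intro mult_right_mono h) simp
    then show ?thesis using h(2)[of u v] by linarith
  qed
  have lenB: "integral (B i) (\<lambda>_. y) = y / N" for i and y :: real
    unfolding B_def using N by (simp add: field_simps)
  have up: "integral (B i) (\<lambda>u. h u * g u) \<le> c * (m * integral (B i) h)" for i
  proof -
    \<comment> \<open>The slow factor is frozen at an arbitrary point \<open>v\<close> of the block.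
      Integrating over \<open>v\<close> afterwards turns \<open>h v\<close> into the block integral
      of \<open>h\<close>; the left side, constant in \<open>v\<close>, only gains the block length
      \<open>1 / N\<close>.\<close>
    have *: "integral (B i) (\<lambda>u. h u * g u) \<le> c * h v * (m / N)" if v: "v \<in> B i" for v
    proof -
      have "integral (B i) (\<lambda>u. h u * g u) \<le> integral (B i) (\<lambda>u. c * h v * g u)"
        using osc[OF _ v] g0 unfolding B_def
        by (intro integral_le int conthg continuous_intros contg mult_right_mono) (auto simp: B_def)
      then show ?thesis by (simp add: gB)
    qed
    have "integral (B i) (\<lambda>v. integral (B i) (\<lambda>u. h u * g u)) \<le> integral (B i) (\<lambda>v. c * (m / N) * h v)"
      using * unfolding B_def
      by (intro integral_le int continuous_intros h) (auto simp: mult_ac)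
    then have "integral (B i) (\<lambda>u. h u * g u) / N \<le> c * (m / N) * integral (B i) h"
      by (simp add: lenB)
    then show ?thesis using N by (simp add: field_simps split: if_splits)
  qed
  have low: "m * integral (B i) h \<le> c * integral (B i) (\<lambda>u. h u * g u)" for i
  proof -
    have *: "h v * (m / N) \<le> c * integral (B i) (\<lambda>u. h u * g u)" if v: "v \<in> B i" for v
    proof -
      have "integral (B i) (\<lambda>u. h v * g u) \<le> integral (B i) (\<lambda>u. c * (h u * g u))"
        using osc[OF v] g0 unfolding B_def mult.assoc[symmetric]
        by (intro integral_le int continuous_intros contg h mult_right_mono) (auto simp: B_def)
      then show ?thesis by (simp add: gB)
    qed
    have "integral (B i) (\<lambda>v. (m / N) * h v) \<le> integral (B i) (\<lambda>v. c * integral (B i) (\<lambda>u. h u * g u))"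
      using * unfolding B_def
      by (intro integral_le int continuous_intros h) (auto simp: mult_ac)
    then have "(m / N) * integral (B i) h \<le> c * integral (B i) (\<lambda>u. h u * g u) / N"
      by (simp add: lenB)
    then show ?thesis using N by (simp add: field_simps split: if_splits)
  qed
  have split: "integral {0..real (Suc i) / N} p = integral {0..real i / N} p + integral (B i) p"
    if "continuous_on UNIV p" for p :: "real \<Rightarrow> real" and i
    unfolding B_def
    by (rule Henstock_Kurzweil_Integration.integral_combine[symmetric]) (use that N in \<open>auto intro!: int divide_right_mono\<close>)
  \<comment> \<open>The block estimates add up with the same constant \<open>c\<close>; the case
    \<open>i = N\<close> is the unit interval.\<close>
  have "integral {0..real i / N} (\<lambda>u. h u * g u) \<le> c * (m * integral {0..real i / N} h) \<and>
        m * integral {0..real i / N} h \<le> c * integral {0..real i / N} (\<lambda>u. h u * g u)" for i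
  proof (induction i)
    case (Suc i)
    then show ?case
      using up[of i] low[of i] by (simp only: split h(1) conthg distrib_left) linarith
  qed simp
  from this[of N] show "integral {0..1} (\<lambda>u. h u * f (real N * u))
           \<le> exp (K / N) * (integral {0..1} f * integral {0..1} h)"
    and "integral {0..1} f * integral {0..1} h
           \<le> exp (K / N) * integral {0..1} (\<lambda>u. h u * f (real N * u))"
    using N by (simp_all add: c_def m_def g_def)
qed

section \<open>Integrals over the unit interval and the Lipschitz bound for the cosine\<close>

lemma integral_exp_pos:
  fixes g :: "real \<Rightarrow> real"
  assumes "continuous_on {0..1} g"
  shows "integral {0..1} (\<lambda>u. exp (g u)) > 0"
proof -
  obtain b where b: "\<And>u. u \<in> {0..1} \<Longrightarrow> g b \<le> g u"
    using continuous_attains_inf[OF _ _ assms] by force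
  have "integral {0..1::real} (\<lambda>_. exp (g b)) \<le> integral {0..1} (\<lambda>u. exp (g u))"
    by (intro integral_le integrable_continuous_real continuous_intros assms) (use b in auto)
  then show ?thesis
    using less_le_trans[OF exp_gt_zero[of "g b"]] by simp
qed

text \<open>Passes from the Lebesgue integral in \<open>tilde_Lambda\<close> to the gauge integral,
  in which the block computations are done.\<close>

lemma integral_uniform_measure_unit:
  fixes g :: "real \<Rightarrow> real"
  assumes "continuous_on UNIV g"
  shows "(\<integral>u. g u \<partial>uniform_measure lborel {0..1}) = integral {0..1} g"
proof -
  have "g \<in> borel_measurable borel"
    by (rule borel_measurable_continuous_onI[OF assms])
  moreover have "uniform_measure lborel {0..1::real} = density lborel (\<lambda>u. ennreal (indicator {0..1} u))"
    by (simp add: uniform_measure_def ennreal_indicator divide_ennreal_def)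
  ultimately have "(\<integral>u. g u \<partial>uniform_measure lborel {0..1}) = (LINT u : {0..1} | lborel. g u)"
    by (simp add: integral_density set_lebesgue_integral_def)
  then show ?thesis
    using set_borel_integral_eq_integral(2)[OF borel_integrable_atLeastAtMost'[OF continuous_on_subset[OF assms]]]
    by simp
qed

lemma tilde_Lambda_eq: "tilde_Lambda \<theta> = ln (integral {0..1} (\<lambda>u. exp (\<theta> * cos (2 * pi * u))))"
  unfolding tilde_Lambda_def by (subst integral_uniform_measure_unit) (auto intro!: continuous_intros)

lemma abs_cos_diff_le: "\<bar>cos x - cos y\<bar> \<le> \<bar>x - y\<bar>" for x y :: real
proof (cases x y rule: linorder_cases)
  case less
  then obtain z where "cos y - cos x = (y - x) * - sin z"
    using MVT2[of x y cos "\<lambda>z. - sin z"] by (auto intro: DERIV_cos)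
  then have "\<bar>cos x - cos y\<bar> = \<bar>x - y\<bar> * \<bar>sin z\<bar>"
    by (metis abs_minus_cancel abs_minus_commute abs_mult)
  then show ?thesis
    using mult_left_mono[of "\<bar>sin z\<bar>" 1 "\<bar>x - y\<bar>"] by simp
next
  case greater
  then obtain z where "cos x - cos y = (x - y) * - sin z"
    using MVT2[of y x cos "\<lambda>z. - sin z"] by (auto intro: DERIV_cos)
  then have "\<bar>cos x - cos y\<bar> = \<bar>x - y\<bar> * \<bar>sin z\<bar>"
    by (metis abs_minus_cancel abs_mult)
  then show ?thesis
    using mult_left_mono[of "\<bar>sin z\<bar>" 1 "\<bar>x - y\<bar>"] by simp
qed simp

text \<open>The averaging bounds apply with \<open>h\<close> built from the first \<open>n\<close>
  cosines, \<open>f\<close> from the next one, and \<open>N = a (Suc n)\<close>. Their logarithms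
  give the two sides of the absolute value.\<close>

lemma lacunary_mgf_step:
  fixes a :: "nat \<Rightarrow> nat" and \<theta> :: real
  assumes pos: "\<And>k. k \<ge> 1 \<Longrightarrow> a k > 0"
  defines "m n \<equiv> integral {0..1} (\<lambda>u. exp (\<theta> * (\<Sum>k=1..n. cos (2 * pi * a k * u))))"
  shows "\<bar>ln (m (Suc n)) - ln (m n) - tilde_Lambda \<theta>\<bar>
           \<le> 2 * pi * \<bar>\<theta>\<bar> * ((\<Sum>k=1..n. real (a k)) / a (Suc n))"
proof -
  define S where "S u = (\<Sum>k=1..n. cos (2 * pi * a k * u))" for u :: real
  define h where "h u = exp (\<theta> * S u)" for u
  define f where "f u = exp (\<theta> * cos (2 * pi * u))" for u
  define K where "K = 2 * pi * \<bar>\<theta>\<bar> * (\<Sum>k=1..n. real (a k))"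
  have K: "K \<ge> 0" unfolding K_def by (intro mult_nonneg_nonneg sum_nonneg) auto
  have Sdiff: "\<bar>S u - S v\<bar> \<le> 2 * pi * (\<Sum>k=1..n. real (a k)) * \<bar>u - v\<bar>" for u v
  proof -
    have "\<bar>S u - S v\<bar> \<le> (\<Sum>k=1..n. \<bar>cos (2 * pi * a k * u) - cos (2 * pi * a k * v)\<bar>)"
      unfolding S_def sum_subtractf[symmetric] by (rule sum_abs)
    also have "\<dots> \<le> (\<Sum>k=1..n. \<bar>2 * pi * a k * u - 2 * pi * a k * v\<bar>)"
      by (intro sum_mono abs_cos_diff_le)
    also have "\<dots> = (\<Sum>k=1..n. 2 * pi * a k * \<bar>u - v\<bar>)"
      by (simp add: right_diff_distrib[symmetric] abs_mult)
    finally show ?thesis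
      by (simp add: sum_distrib_left sum_distrib_right)
  qed
  have hosc: "h u \<le> exp (K * \<bar>u - v\<bar>) * h v" for u v
  proof -
    have "\<theta> * (S u - S v) \<le> \<bar>\<theta>\<bar> * \<bar>S u - S v\<bar>"
      by (metis abs_ge_self abs_mult)
    also have "\<dots> \<le> \<bar>\<theta>\<bar> * (2 * pi * (\<Sum>k=1..n. real (a k)) * \<bar>u - v\<bar>)"
      by (intro mult_left_mono Sdiff) auto
    finally show ?thesis
      by (simp add: h_def exp_add[symmetric] K_def algebra_simps)
  qed
  have conth: "continuous_on UNIV h" and contf: "continuous_on UNIV f"
    unfolding h_def f_def S_def by (intro continuous_intros)+
  have per: "f (x + 1) = f x" for x
    unfolding f_def by (simp add: distrib_left)
  have apos: "a (Suc n) > 0" using pos by simp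
  define P where "P = integral {0..1} f"
  have mn: "m n = integral {0..1} h"
    unfolding m_def h_def S_def ..
  have mSn: "m (Suc n) = integral {0..1} (\<lambda>u. h u * f (real (a (Suc n)) * u))"
    unfolding m_def h_def S_def f_def
    by (simp add: exp_add distrib_left mult_ac)
  have bounds: "m (Suc n) \<le> exp (K / a (Suc n)) * (P * m n)"
    "P * m n \<le> exp (K / a (Suc n)) * m (Suc n)"
    using integral_mult_periodic_bounds[of f h K "a (Suc n)"] contf per conth hosc apos K
    unfolding P_def mn mSn by (auto simp: f_def h_def)
  have mpos: "m j > 0" for j
    unfolding m_def by (intro integral_exp_pos continuous_intros)
  have Ppos: "P > 0"
    unfolding P_def f_def by (intro integral_exp_pos continuous_intros)
  have LP: "tilde_Lambda \<theta> = ln P"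
    unfolding tilde_Lambda_eq P_def f_def ..
  have "ln (m (Suc n)) \<le> ln (exp (K / a (Suc n)) * (P * m n))"
    using bounds mpos by (intro ln_mono) auto
  then have 1: "ln (m (Suc n)) \<le> K / a (Suc n) + (ln P + ln (m n))"
    using mpos[of n] Ppos by (simp add: ln_mult)
  have "ln (P * m n) \<le> ln (exp (K / a (Suc n)) * m (Suc n))"
    using bounds mpos Ppos by (intro ln_mono) auto
  then have 2: "ln P + ln (m n) \<le> K / a (Suc n) + ln (m (Suc n))"
    using mpos[of n] mpos[of "Suc n"] Ppos by (simp add: ln_mult)
  show ?thesis
    using 1 2 unfolding LP K_def by (simp add: abs_le_iff)
qed

text \<open>The ratios satisfy \<open>r (Suc n) = (r n + 1) * q n\<close> with \<open>q\<close>
  tending to 0. This first keeps \<open>r\<close> bounded, and then the same recursion forces it to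
  0.\<close>

lemma lacunary_partial_sum_ratio:
  fixes a :: "nat \<Rightarrow> nat"
  assumes pos: "\<And>k. k \<ge> 1 \<Longrightarrow> a k > 0"
    and gap: "filterlim (\<lambda>k. real (a (k + 1)) / real (a k)) at_top sequentially"
  shows "(\<lambda>n. (\<Sum>k=1..n. real (a k)) / a (Suc n)) \<longlonglongrightarrow> 0"
proof -
  define r where "r n = (\<Sum>k=1..n. real (a k)) / a (Suc n)" for n
  \<comment> \<open>The index starts at \<open>Suc n\<close> because only \<open>a k\<close> with
    \<open>k \<ge> 1\<close> is known to be positive.\<close>
  define q where "q n = real (a (Suc n)) / a (Suc (Suc n))" for n
  have r0: "r n \<ge> 0" for n unfolding r_def by (intro divide_nonneg_nonneg sum_nonneg) auto
  have q0: "q n \<ge> 0" for n unfolding q_def by simp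
  have "(\<lambda>k. inverse (real (a (k + 1)) / real (a k))) \<longlonglongrightarrow> 0"
    by (rule filterlim_compose[OF tendsto_inverse_0_at_top[OF filterlim_ident] gap])
  from LIMSEQ_Suc[OF this] have q: "q \<longlonglongrightarrow> 0"
    unfolding q_def by simp
  have rec: "r (Suc n) = (r n + 1) * q n" for n
    using pos[of "Suc n"] unfolding r_def q_def by (simp add: add_divide_distrib distrib_right)
  obtain N where N: "\<And>n. n \<ge> N \<Longrightarrow> q n < 1 / 2"
    using LIMSEQ_D[OF q, of "1 / 2"] by fastforce
  \<comment> \<open>The lower bound 1 gives \<open>(C + 1) / 2 \<le> C\<close>, so the bound passes
    to the next index once \<open>q n < 1 / 2\<close>.\<close>
  define C where "C = max 1 (r N)"
  have bnd: "r n \<le> C" if "n \<ge> N" for n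
    using that
  proof (induction n rule: dec_induct)
    case (step n)
    have "r (Suc n) \<le> (C + 1) * (1 / 2)"
      unfolding rec using step N[of n] r0 q0 by (intro mult_mono) (auto simp: C_def)
    also have "\<dots> \<le> C" unfolding C_def by simp
    finally show ?case .
  qed (simp add: C_def)
  have "(\<lambda>n. (C + 1) * q n) \<longlonglongrightarrow> 0"
    using tendsto_mult_right_zero[OF q] by simp
  moreover have "\<forall>\<^sub>F n in sequentially. norm (r (Suc n)) \<le> (C + 1) * q n"
    using eventually_ge_at_top[of N]
  proof eventually_elim
    case (elim n)
    have "(r n + 1) * q n \<le> (C + 1) * q n"
      using bnd[OF elim] q0 by (intro mult_right_mono) auto
    moreover have "norm (r (Suc n)) = r (Suc n)" using r0 by simp
    ultimately show ?case by (simp only: rec)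
  qed
  ultimately have "(\<lambda>n. r (Suc n)) \<longlonglongrightarrow> 0"
    by (rule Lim_null_comparison[rotated])
  then show ?thesis
    unfolding r_def[symmetric] by (rule LIMSEQ_imp_Suc)
qed

lemma lacunary_log_mgf_limit:
  fixes a :: "nat \<Rightarrow> nat"
  assumes "\<And>k. k \<ge> 1 \<Longrightarrow> a k > 0"
    and "filterlim (\<lambda>k. real (a (k + 1)) / real (a k)) at_top sequentially"
  shows "(\<lambda>n. ln (integral {0..1} (\<lambda>u. exp (\<theta> * (\<Sum>k=1..n. cos (2 * pi * a k * u))))) / n)
           \<longlonglongrightarrow> tilde_Lambda \<theta>"
proof (rule tendsto_of_increments)
  let ?x = "\<lambda>n. ln (integral {0..1} (\<lambda>u. exp (\<theta> * (\<Sum>k=1..n. cos (2 * pi * a k * u)))))"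
  have lim: "(\<lambda>n. 2 * pi * \<bar>\<theta>\<bar> * ((\<Sum>k=1..n. real (a k)) / a (Suc n))) \<longlonglongrightarrow> 0"
    by (rule tendsto_mult_right_zero[OF lacunary_partial_sum_ratio[OF assms]])
  have bnd: "norm (?x (Suc n) - ?x n - tilde_Lambda \<theta>)
      \<le> 2 * pi * \<bar>\<theta>\<bar> * ((\<Sum>k=1..n. real (a k)) / a (Suc n))" for n
    using lacunary_mgf_step[OF assms(1), where \<theta> = \<theta> and n = n] by simp
  have "(\<lambda>n. ?x (Suc n) - ?x n - tilde_Lambda \<theta>) \<longlonglongrightarrow> 0"
    by (rule Lim_null_comparison[OF always_eventually[OF allI[OF bnd]] lim])
  then show "(\<lambda>n. ?x (Suc n) - ?x n) \<longlonglongrightarrow> tilde_Lambda \<theta>"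
    by (rule LIM_zero_cancel)
qed

subsection \<open>The Gaertner--Ellis theorem on the real line\<close>

lemma eventually_exp_neg_le:
  assumes "c > 0" "C > (0::real)"
  shows "\<forall>\<^sub>F n in sequentially. exp (- (real n * c)) \<le> C"
proof -
  have "filterlim (\<lambda>n. - (real n * c)) at_bot sequentially"
    using assms by real_asymp
  then have "(\<lambda>n. exp (- (real n * c))) \<longlonglongrightarrow> 0"
    by (rule filterlim_compose[OF exp_at_bot])
  from order_tendstoD(2)[OF this \<open>C > 0\<close>] show ?thesis
    by (rule eventually_mono) simp
qed

lemma scaled_ext_log_le:
  assumes "n > 0" "0 \<le> p" "p \<le> exp (- (real n * r))"
  shows "ereal (1 / real n) * ext_log p \<le> - ereal r"
proof (cases "p = 0")
  case False
  then have "ln p \<le> - (n * r)"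
    using assms ln_mono[of p "exp (- (n * r))"] by simp
  then show ?thesis
    using assms False by (simp add: ext_log_def field_simps)
qed (use assms in \<open>simp add: ext_log_def\<close>)

lemma scaled_ext_log_ge:
  assumes "n > 0" "exp (real n * c) \<le> p"
  shows "ereal c \<le> ereal (1 / real n) * ext_log p"
proof -
  have p: "p > 0" using assms exp_gt_zero[of "n * c"] by linarith
  then have "n * c \<le> ln p"
    using assms ln_mono[of "exp (n * c)" p] by simp
  then show ?thesis
    using assms p by (simp add: ext_log_def field_simps)
qed

section \<open>Limiting cumulants, exponential tilting and the lower bound\<close>

locale scaled_cgf = prob_space +
  fixes S :: "nat \<Rightarrow> 'a \<Rightarrow> real" and \<Lambda> :: "real \<Rightarrow> real"
  assumes random_variable_S [measurable]: "\<And>n. random_variable borel (S n)"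
    and integrable_exp: "\<And>n \<theta>. integrable M (\<lambda>\<omega>. exp (\<theta> * S n \<omega>))"
    and log_mgf_limit:
      "\<And>\<theta>. (\<lambda>n. ln (expectation (\<lambda>\<omega>. exp (\<theta> * S n \<omega>))) / n) \<longlonglongrightarrow> \<Lambda> \<theta>"
begin

definition mgf :: "nat \<Rightarrow> real \<Rightarrow> real" where
  "mgf n \<theta> = expectation (\<lambda>\<omega>. exp (\<theta> * S n \<omega>))"

definition rate :: "real \<Rightarrow> ereal" where
  "rate x = (SUP \<theta>. ereal (\<theta> * x - \<Lambda> \<theta>))"

text \<open>Dividing by \<open>mgf n \<theta>\<close> would give the exponentially tilted law of
  \<open>S n\<close>. Without this normalisation, \<theta> = 0 gives ordinary probabilities.\<close>

definition tilted :: "real \<Rightarrow> nat \<Rightarrow> (real \<Rightarrow> bool) \<Rightarrow> real" where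
  "tilted \<theta> n P = expectation (\<lambda>\<omega>. exp (\<theta> * S n \<omega>) * indicator {\<omega> \<in> space M. P (S n \<omega>)} \<omega>)"

lemma mgf_pos: "mgf n \<theta> > 0"
  unfolding mgf_def by (rule expectation_greater[OF integrable_exp]) simp

lemma Lambda_0: "\<Lambda> 0 = 0"
  using LIMSEQ_unique[OF log_mgf_limit[of 0], of 0] by (simp add: prob_space)

lemma eventually_mgf_le:
  assumes "e > 0"
  shows "\<forall>\<^sub>F n in sequentially. mgf n \<theta> \<le> exp (n * (\<Lambda> \<theta> + e))"
proof -
  have "\<forall>\<^sub>F n in sequentially. ln (mgf n \<theta>) / n < \<Lambda> \<theta> + e"
    using order_tendstoD(2)[OF log_mgf_limit[of \<theta>], of "\<Lambda> \<theta> + e"] assms by (simp add: mgf_def)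
  then show ?thesis
    using eventually_gt_at_top[of 0]
  proof eventually_elim
    case (elim n)
    then have "ln (mgf n \<theta>) \<le> n * (\<Lambda> \<theta> + e)"
      by (simp add: field_simps)
    then show ?case
      using exp_ln[OF mgf_pos[of n \<theta>]] by (metis exp_le_cancel_iff)
  qed
qed

lemma eventually_mgf_ge:
  assumes "e > 0"
  shows "\<forall>\<^sub>F n in sequentially. exp (n * (\<Lambda> \<theta> - e)) \<le> mgf n \<theta>"
proof -
  have "\<forall>\<^sub>F n in sequentially. ln (mgf n \<theta>) / n > \<Lambda> \<theta> - e"
    using order_tendstoD(1)[OF log_mgf_limit[of \<theta>], of "\<Lambda> \<theta> - e"] assms by (simp add: mgf_def)
  then show ?thesis
    using eventually_gt_at_top[of 0]
  proof eventually_elim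
    case (elim n)
    then have "n * (\<Lambda> \<theta> - e) \<le> ln (mgf n \<theta>)"
      by (simp add: field_simps)
    then show ?case
      using exp_ln[OF mgf_pos[of n \<theta>]] by (metis exp_le_cancel_iff)
  qed
qed

text \<open>Chernoff's argument: on the event the factor \<open>exp (\<eta> * (s - n * y))\<close>
  is at least 1, and inserting it moves the tilt from \<theta> to \<theta> + \<eta>. The sign of
  \<eta> selects the upper or the lower half-line, so both tails are covered at once.\<close>

lemma tilted_halfline_le:
  "tilted \<theta> n (\<lambda>s. \<eta> * (real n * y) \<le> \<eta> * s) \<le> exp (- (n * (\<eta> * y))) * mgf n (\<theta> + \<eta>)"
proof -
  have "exp (\<theta> * s) * indicator {\<omega> \<in> space M. \<eta> * (real n * y) \<le> \<eta> * S n \<omega>} \<omega>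
      \<le> exp (- (n * (\<eta> * y))) * exp ((\<theta> + \<eta>) * s)" if "s = S n \<omega>" for s \<omega>
    using that by (auto simp: indicator_def exp_add[symmetric] algebra_simps)
  then have "tilted \<theta> n (\<lambda>s. \<eta> * (real n * y) \<le> \<eta> * s)
      \<le> expectation (\<lambda>\<omega>. exp (- (n * (\<eta> * y))) * exp ((\<theta> + \<eta>) * S n \<omega>))"
    unfolding tilted_def
    by (intro integral_mono integrable_real_mult_indicator integrable_mult_right integrable_exp)
      auto
  then show ?thesis by (simp add: mgf_def)
qed

text \<open>The hypothesis makes the Chernoff bound exponentially smaller than the total mass
  \<open>mgf n \<theta>\<close>. The constant 4 lets two such tails together take at most half of
  that mass.\<close>

lemma tilted_halfline_negligible:
  assumes "\<Lambda> (\<theta> + \<eta>) < \<Lambda> \<theta> + \<eta> * y"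
  shows "\<forall>\<^sub>F n in sequentially. tilted \<theta> n (\<lambda>s. \<eta> * (real n * y) \<le> \<eta> * s) \<le> mgf n \<theta> / 4"
proof -
  \<comment> \<open>One third of the gap is lost in each of the two approximations of
    \<open>mgf\<close>; the last third gives the decay \<open>exp (- (n * e))\<close>.\<close>
  define e where "e = (\<Lambda> \<theta> + \<eta> * y - \<Lambda> (\<theta> + \<eta>)) / 3"
  have e: "e > 0" using assms by (simp add: e_def)
  show ?thesis
    using eventually_mgf_le[OF e, of "\<theta> + \<eta>"] eventually_mgf_ge[OF e, of \<theta>]
      eventually_exp_neg_le[OF e, of "1 / 4", simplified]
  proof eventually_elim
    case (elim n)
    have "tilted \<theta> n (\<lambda>s. \<eta> * (real n * y) \<le> \<eta> * s)
        \<le> exp (- (n * (\<eta> * y))) * exp (n * (\<Lambda> (\<theta> + \<eta>) + e))"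
      by (rule order_trans[OF tilted_halfline_le mult_left_mono[OF elim(1)]]) simp
    also have "\<dots> = exp (- (n * e)) * exp (n * (\<Lambda> \<theta> - e))"
    proof -
      have L: "\<Lambda> (\<theta> + \<eta>) = \<Lambda> \<theta> + \<eta> * y - 3 * e"
        by (simp add: e_def field_simps)
      show ?thesis
        unfolding L exp_add[symmetric] by (simp add: algebra_simps)
    qed
    also have "\<dots> \<le> (1 / 4) * mgf n \<theta>"
      using elim by (intro mult_mono) auto
    finally show ?case by simp
  qed
qed

text \<open>Under the law with density proportional to \<open>exp (\<theta> * S n)\<close>, both \<open>S n / n \<ge> x + \<delta>\<close> and
  \<open>S n / n \<le> x - \<delta>\<close> have exponentially small probability as \<open>\<Lambda>\<close> has slope \<open>x\<close> at \<open>\<theta>\<close>.\<close>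

lemma exposed_point_lower_bound:
  assumes deriv: "(\<Lambda> has_real_derivative x) (at \<theta>)" and G: "open G" "x \<in> G" and e: "e > 0"
    and A: "G \<subseteq> A" "A \<in> sets borel"
  shows "\<forall>\<^sub>F n in sequentially.
    exp (n * (\<Lambda> \<theta> - \<theta> * x - e)) \<le> prob {\<omega> \<in> space M. S n \<omega> / n \<in> A}"
proof -
  obtain d where d: "d > 0" "ball x d \<subseteq> G"
    using G by (meson openE)
  \<comment> \<open>The second entry bounds the variation of the exponent
    \<open>\<theta> * s / n\<close> on the ball by \<open>e / 3\<close>; the added 1 keeps the
    denominator positive when \<theta> = 0.\<close>
  define \<delta> where "\<delta> = min d (e / (3 * (\<bar>\<theta>\<bar> + 1)))"
  have \<delta>: "\<delta> > 0" "ball x \<delta> \<subseteq> A" "\<bar>\<theta>\<bar> * \<delta> \<le> e / 3"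
  proof -
    show "\<delta> > 0" unfolding \<delta>_def using d e by simp
    show "ball x \<delta> \<subseteq> A" using d(2) A(1) by (auto simp: \<delta>_def)
    have "(\<bar>\<theta>\<bar> + 1) * \<delta> \<le> (\<bar>\<theta>\<bar> + 1) * (e / (3 * (\<bar>\<theta>\<bar> + 1)))"
      unfolding \<delta>_def by (intro mult_left_mono) auto
    also have "\<dots> = e / 3"
      by (simp add: field_simps add_eq_0_iff_both_eq_0)
    finally show "\<bar>\<theta>\<bar> * \<delta> \<le> e / 3"
      using \<open>\<delta> > 0\<close> by (simp add: distrib_right)
  qed
  \<comment> \<open>Subtracting a line steeper than the tangent leaves a function decreasing at
    \<theta>, so a small step to the right satisfies the hypothesis of
    \<open>tilted_halfline_negligible\<close>. The lower tail uses a flatter line and a step to the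
    left.\<close>
  have "((\<lambda>t. \<Lambda> t - t * (x + \<delta>)) has_real_derivative - \<delta>) (at \<theta>)"
    using deriv by (auto intro!: derivative_eq_intros)
  then obtain d1 where d1: "d1 > 0" 
    "\<And>h. h > 0 \<Longrightarrow> h < d1 \<Longrightarrow> \<Lambda> (\<theta> + h) - (\<theta> + h) * (x + \<delta>) < \<Lambda> \<theta> - \<theta> * (x + \<delta>)"
    using DERIV_neg_dec_right[of _ "- \<delta>"] \<delta>(1) by fastforce
  define \<eta>1 where "\<eta>1 = d1 / 2"
  have \<eta>1: "\<eta>1 > 0" "\<Lambda> (\<theta> + \<eta>1) < \<Lambda> \<theta> + \<eta>1 * (x + \<delta>)"
    using d1(1) d1(2)[of \<eta>1] by (simp_all add: \<eta>1_def algebra_simps)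
  have "((\<lambda>t. \<Lambda> t - t * (x - \<delta>)) has_real_derivative \<delta>) (at \<theta>)"
    using deriv by (auto intro!: derivative_eq_intros)
  then obtain d2 where d2: "d2 > 0" 
    "\<And>h. h > 0 \<Longrightarrow> h < d2 \<Longrightarrow> \<Lambda> (\<theta> - h) - (\<theta> - h) * (x - \<delta>) < \<Lambda> \<theta> - \<theta> * (x - \<delta>)"
    using DERIV_pos_inc_left[of _ "\<delta>"] \<delta>(1) by fastforce
  define \<eta>2 where "\<eta>2 = - (d2 / 2)"
  have \<eta>2: "\<eta>2 < 0" "\<Lambda> (\<theta> + \<eta>2) < \<Lambda> \<theta> + \<eta>2 * (x - \<delta>)"
    using d2(1) d2(2)[of "d2 / 2"] by (simp_all add: \<eta>2_def algebra_simps)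
  have "\<forall>\<^sub>F n in sequentially. exp (- (real n * (e / 3))) \<le> 1 / 2"
    using eventually_exp_neg_le[of "e / 3" "1 / 2"] e by simp
  moreover have "\<forall>\<^sub>F n in sequentially. exp (n * (\<Lambda> \<theta> - e / 3)) \<le> mgf n \<theta>"
    using e by (intro eventually_mgf_ge) simp
  ultimately show ?thesis
    using tilted_halfline_negligible[OF \<eta>1(2)] tilted_halfline_negligible[OF \<eta>2(2)]
      eventually_gt_at_top[of 0]
  proof eventually_elim
    case (elim n)
    define up where "up s \<longleftrightarrow> \<eta>1 * (real n * (x + \<delta>)) \<le> \<eta>1 * s" for s
    define lo where "lo s \<longleftrightarrow> \<eta>2 * (real n * (x - \<delta>)) \<le> \<eta>2 * s" for s
    define mid where "mid s \<longleftrightarrow> s / n \<in> A" for s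
    have [measurable]: "Measurable.pred borel up" "Measurable.pred borel lo"
      "Measurable.pred borel mid"
      unfolding up_def lo_def mid_def using A(2) by measurable
    have n: "real n > 0" using elim by simp
    \<comment> \<open>Outside both tails \<open>s / n\<close> lies in the \<delta>-ball around
      \<open>x\<close>, hence in \<open>A\<close>. The bounds on \<open>s\<close> are kept in order
      to control the tilting weight there.\<close>
    have cases: "up s \<or> lo s \<or> (mid s \<and> s \<le> n * (x + \<delta>) \<and> n * (x - \<delta>) \<le> s)" for s
    proof -
      have "up s \<longleftrightarrow> n * (x + \<delta>) \<le> s" "lo s \<longleftrightarrow> s \<le> n * (x - \<delta>)"
        using \<eta>1(1) \<eta>2(1) by (simp_all add: up_def lo_def)
      moreover have "mid s" if "n * (x - \<delta>) < s" "s < n * (x + \<delta>)"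
      proof -
        have "x - \<delta> < s / n" "s / n < x + \<delta>"
          using that n by (simp_all add: field_simps)
        then have "s / n \<in> ball x \<delta>"
          by (simp add: dist_real_def)
        then show ?thesis using \<delta>(2) by (auto simp: mid_def)
      qed
      ultimately show ?thesis by linarith
    qed
    define E where "E = exp (n * (\<theta> * x + e / 3))"
    have bound: "exp (\<theta> * s) \<le> E" if "s \<le> n * (x + \<delta>)" "n * (x - \<delta>) \<le> s" for s
    proof -
      have "\<bar>s - n * x\<bar> \<le> n * \<delta>"
        using that by (simp add: abs_le_iff algebra_simps)
      then have "\<bar>\<theta>\<bar> * \<bar>s - n * x\<bar> \<le> n * (\<bar>\<theta>\<bar> * \<delta>)"
        using mult_left_mono[of _ _ "\<bar>\<theta>\<bar>"] by (simp add: mult.left_commute)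
      also have "\<dots> \<le> n * (e / 3)"
        using \<delta>(3) by (intro mult_left_mono) auto
      finally have "\<theta> * (s - n * x) \<le> n * (e / 3)"
        by (metis abs_ge_self abs_mult order_trans)
      then show ?thesis by (simp add: E_def algebra_simps)
    qed
    let ?ind = "\<lambda>P. indicator {\<omega> \<in> space M. P (S n \<omega>)} :: 'a \<Rightarrow> real"
    have int: "integrable M (\<lambda>\<omega>. exp (\<theta> * S n \<omega>) * ?ind P \<omega>)"
      if [measurable]: "Measurable.pred borel P" for P
      by (intro integrable_real_mult_indicator integrable_exp) measurable
    have intE: "integrable M (\<lambda>\<omega>. E * ?ind mid \<omega>)"
      by (intro integrable_mult_right integrable_real_indicator) (measurable, simp add: emeasure_eq_measure)
    have "mgf n \<theta> \<le> expectation (\<lambda>\<omega>. exp (\<theta> * S n \<omega>) * ?ind up \<omega>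
        + exp (\<theta> * S n \<omega>) * ?ind lo \<omega> + E * ?ind mid \<omega>)"
      unfolding mgf_def
    proof (intro integral_mono integrable_exp Bochner_Integration.integrable_add int intE)
      fix \<omega> assume "\<omega> \<in> space M"
      then show "exp (\<theta> * S n \<omega>) \<le> exp (\<theta> * S n \<omega>) * ?ind up \<omega>
          + exp (\<theta> * S n \<omega>) * ?ind lo \<omega> + E * ?ind mid \<omega>"
        using cases[of "S n \<omega>"] bound[of "S n \<omega>"] exp_gt_zero[of "\<theta> * S n \<omega>"]
        by (auto simp: indicator_def E_def)
    qed measurable
    also have "\<dots> = tilted \<theta> n up + tilted \<theta> n lo + E * prob {\<omega> \<in> space M. mid (S n \<omega>)}"
      using int[of up] int[of lo] intE
      by (simp add: tilted_def Int_def conj_commute)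
    also have "\<dots> \<le> mgf n \<theta> / 4 + mgf n \<theta> / 4 + E * prob {\<omega> \<in> space M. mid (S n \<omega>)}"
      using elim unfolding up_def lo_def by (intro add_mono) auto
    finally have "mgf n \<theta> * (1 / 2) \<le> E * prob {\<omega> \<in> space M. mid (S n \<omega>)}"
      by simp
    \<comment> \<open>The error \<open>e\<close> is spent in thirds: on the lower bound for
      \<open>mgf\<close>, on absorbing the factor \<open>1 / 2\<close>, and on the weight bound
      \<open>E\<close>.\<close>
    moreover have "exp (n * (\<Lambda> \<theta> - e / 3)) * exp (- (n * (e / 3))) \<le> mgf n \<theta> * (1 / 2)"
      using elim mgf_pos[of n \<theta>] by (intro mult_mono) auto
    ultimately have "exp (n * (\<Lambda> \<theta> - e / 3)) * exp (- (n * (e / 3))) \<le> E * prob {\<omega> \<in> space M. mid (S n \<omega>)}"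
      by linarith
    moreover have "exp (n * (\<Lambda> \<theta> - e / 3)) * exp (- (n * (e / 3))) = E * exp (n * (\<Lambda> \<theta> - \<theta> * x - e))"
      by (simp add: E_def exp_add[symmetric] algebra_simps)
    ultimately show ?case
      by (simp add: E_def mid_def)
  qed
qed

section \<open>The upper bound and properties of the rate function\<close>

text \<open>\<open>B\<close> lies beyond \<open>y\<close> as seen from 0. If the \<theta> witnessing
  \<open>r < rate y\<close> points outwards, this is a Chernoff bound; otherwise
  \<open>\<theta> * y \<le> 0\<close>, so nonnegativity of \<Lambda> gives \<open>r \<le> 0\<close>
  and the claim is trivial.\<close>

lemma halfline_upper_bound:
  fixes r :: real
  assumes nonneg: "\<And>\<theta>. \<Lambda> \<theta> \<ge> 0" and r: "ereal r < rate y"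
    and B: "B \<in> sets borel" "(0 \<le> y \<and> (\<forall>z\<in>B. y \<le> z)) \<or> (y \<le> 0 \<and> (\<forall>z\<in>B. z \<le> y))"
  shows "\<forall>\<^sub>F n in sequentially. prob {\<omega> \<in> space M. S n \<omega> / n \<in> B} \<le> exp (- (n * r))"
proof -
  obtain \<theta> where \<theta>: "r < \<theta> * y - \<Lambda> \<theta>"
    using r unfolding rate_def by (auto simp: less_SUP_iff)
  show ?thesis
  proof (cases "\<forall>z\<in>B. \<theta> * y \<le> \<theta> * z")
    case True
    define e where "e = \<theta> * y - \<Lambda> \<theta> - r"
    have e: "e > 0" using \<theta> by (simp add: e_def)
    show ?thesis
      using eventually_mgf_le[OF e, of \<theta>] eventually_gt_at_top[of 0]
    proof eventually_elim
      case (elim n)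
      have "prob {\<omega> \<in> space M. S n \<omega> / n \<in> B} \<le> prob {\<omega> \<in> space M. \<theta> * (n * y) \<le> \<theta> * S n \<omega>}"
      proof (intro finite_measure_mono subsetI)
        fix \<omega> assume "\<omega> \<in> {\<omega> \<in> space M. S n \<omega> / n \<in> B}"
        then have "\<omega> \<in> space M" "\<theta> * y \<le> \<theta> * (S n \<omega> / n)" using True by auto
        then show "\<omega> \<in> {\<omega> \<in> space M. \<theta> * (n * y) \<le> \<theta> * S n \<omega>}"
          using elim by (simp add: field_simps)
      qed measurable
      also have "\<dots> = tilted 0 n (\<lambda>s. \<theta> * (n * y) \<le> \<theta> * s)"
        unfolding tilted_def by (simp add: Int_def conj_commute)
      also have "\<dots> \<le> exp (- (n * (\<theta> * y))) * mgf n \<theta>"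
        using tilted_halfline_le[of 0 n \<theta> y] by simp
      also have "\<dots> \<le> exp (- (n * (\<theta> * y))) * exp (n * (\<Lambda> \<theta> + e))"
        using elim by (intro mult_left_mono) auto
      also have "\<dots> = exp (- (n * r))"
        by (simp add: exp_add[symmetric] e_def algebra_simps)
      finally show ?case .
    qed
  next
    case False
    then have "\<theta> * y \<le> 0"
      using B(2) mult_left_mono[of _ _ \<theta>] mult_left_mono_neg[of _ _ \<theta>]
      by (metis linorder_le_cases mult_nonneg_nonpos mult_nonpos_nonneg)
    then have "r \<le> 0" using \<theta> nonneg[of \<theta>] by linarith
    then have "prob {\<omega> \<in> space M. S n \<omega> / n \<in> B} \<le> exp (- (n * r))" for n :: nat
      by (intro order_trans[OF prob_le_1]) (simp add: mult_nonneg_nonpos)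
    then show ?thesis by simp
  qed
qed

lemma rate_nonneg: "rate x \<ge> 0"
  unfolding rate_def by (rule SUP_upper2[of 0]) (auto simp: Lambda_0 zero_ereal_def)

text \<open>Each of the two parts of \<open>F\<close> cut off at 0, if nonempty, has a point nearest
  to 0 and lies in the half-line starting there. Closedness puts this point in \<open>F\<close>, so
  its rate exceeds \<open>r\<close>.\<close>

lemma closed_set_upper_bound:
  fixes r :: real
  assumes nonneg: "\<And>\<theta>. \<Lambda> \<theta> \<ge> 0" and F: "closed F" and r: "\<And>y. y \<in> F \<Longrightarrow> ereal r < rate y"
  shows "\<forall>\<^sub>F n in sequentially. prob {\<omega> \<in> space M. S n \<omega> / n \<in> F} \<le> 2 * exp (- (n * r))"
proof -
  have pos: "\<forall>\<^sub>F n in sequentially. prob {\<omega> \<in> space M. S n \<omega> / n \<in> F \<inter> {0..}} \<le> exp (- (n * r))"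
  proof (cases "F \<inter> {0..} = {}")
    case False
    have bdd: "bdd_below (F \<inter> {0..})" by (auto intro: bdd_belowI[of _ 0])
    have "Inf (F \<inter> {0..}) \<in> F \<inter> {0..}"
      using closed_contains_Inf[OF False bdd] F by auto
    then show ?thesis
      using cInf_lower[OF _ bdd] F
      by (intro halfline_upper_bound[OF nonneg r]) auto
  qed simp
  have neg: "\<forall>\<^sub>F n in sequentially. prob {\<omega> \<in> space M. S n \<omega> / n \<in> F \<inter> {..0}} \<le> exp (- (n * r))"
  proof (cases "F \<inter> {..0} = {}")
    case False
    have bdd: "bdd_above (F \<inter> {..0})" by (auto intro: bdd_aboveI[of _ 0])
    have "Sup (F \<inter> {..0}) \<in> F \<inter> {..0}"
      using closed_contains_Sup[OF False bdd] F by auto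
    then show ?thesis
      using cSup_upper[OF _ bdd] F
      by (intro halfline_upper_bound[OF nonneg r]) auto
  qed simp
  have [measurable]: "F \<in> sets borel" using F by simp
  show ?thesis
    using pos neg
  proof eventually_elim
    case (elim n)
    have "prob {\<omega> \<in> space M. S n \<omega> / n \<in> F}
        \<le> prob ({\<omega> \<in> space M. S n \<omega> / n \<in> F \<inter> {0..}} \<union> {\<omega> \<in> space M. S n \<omega> / n \<in> F \<inter> {..0}})"
      by (intro finite_measure_mono) auto
    also have "\<dots> \<le> prob {\<omega> \<in> space M. S n \<omega> / n \<in> F \<inter> {0..}} + prob {\<omega> \<in> space M. S n \<omega> / n \<in> F \<inter> {..0}}"
      by (intro measure_Un_le) measurable
    finally show ?case using elim by linarith
  qed
qed

text \<open>Moving towards 0 lowers the terms with \<open>\<theta> * x > 0\<close>, and the others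
  stay at most 0, hence below the nonnegative rate. This allows a point to be replaced by one
  slightly nearer to 0 in the lower bound.\<close>

lemma rate_scale:
  assumes nonneg: "\<And>\<theta>. \<Lambda> \<theta> \<ge> 0" and t: "0 \<le> t" "t \<le> 1"
  shows "rate (t * x) \<le> rate x"
  unfolding rate_def[of "t * x"]
proof (rule SUP_least)
  fix \<theta>
  show "ereal (\<theta> * (t * x) - \<Lambda> \<theta>) \<le> rate x"
  proof (cases "\<theta> * x \<le> 0")
    case True
    then have "t * (\<theta> * x) \<le> 0"
      using t by (simp add: mult_nonneg_nonpos)
    then have "ereal (\<theta> * (t * x) - \<Lambda> \<theta>) \<le> 0"
      using nonneg[of \<theta>] by (simp add: mult.left_commute)
    then show ?thesis using rate_nonneg order_trans by blast
  next
    case False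
    then have "t * (\<theta> * x) \<le> 1 * (\<theta> * x)"
      using t by (intro mult_right_mono) auto
    then have "ereal (\<theta> * (t * x) - \<Lambda> \<theta>) \<le> ereal (\<theta> * x - \<Lambda> \<theta>)"
      by (simp add: mult.left_commute)
    also have "\<dots> \<le> rate x"
      unfolding rate_def by (rule SUP_upper) simp
    finally show ?thesis .
  qed
qed

text \<open>A supremum of affine functions has sublevel sets that are intersections of closed
  sets.\<close>

lemma lower_semicontinuous_rate: "lower_semicontinuous rate"
  unfolding lower_semicontinuous_def
proof
  fix c
  have "{x. rate x \<le> c} = (\<Inter>\<theta>. {x. ereal (\<theta> * x - \<Lambda> \<theta>) \<le> c})"
    by (auto simp: rate_def SUP_le_iff)
  also have "closed \<dots>"
    by (intro closed_INT ballI closed_Collect_le continuous_intros)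
  finally show "closed {x. rate x \<le> c}" .
qed

text \<open>The condition \<open>exposed\<close> asks for slopes at \<open>t * x\<close> with
  \<open>t < 1\<close> only, since a boundary point of the domain of \<open>rate\<close> need not be
  a slope of \<Lambda>. The lower bound at \<open>x\<close> is obtained at such a nearby point,
  whose rate is no larger.\<close>

theorem gaertner_ellis:
  assumes nonneg: "\<And>\<theta>. \<Lambda> \<theta> \<ge> 0"
    and exposed: "\<And>x t. rate x < \<infinity> \<Longrightarrow> 0 \<le> t \<Longrightarrow> t < 1 \<Longrightarrow> \<exists>\<theta>. (\<Lambda> has_real_derivative t * x) (at \<theta>)"
  shows "satisfies_LDP (\<lambda>n \<omega>. S n \<omega> / real n) (\<lambda>n. real n) rate"
  unfolding satisfies_LDP_def Let_def
proof (intro conjI allI ballI)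
  show "random_variable borel (\<lambda>\<omega>. S n \<omega> / real n)" for n
    by measurable
  show "incseq real" by (simp add: incseq_def)
  show "filterlim real at_top sequentially" by (rule filterlim_real_sequentially)
  show "0 \<le> rate x" for x by (rule rate_nonneg)
  show "lower_semicontinuous rate" by (rule lower_semicontinuous_rate)
next
  fix A :: "real set" assume A: "A \<in> sets borel"
  have [measurable]: "closure A \<in> sets borel" by simp
  let ?p = "\<lambda>n. prob {\<omega> \<in> space M. S n \<omega> / real n \<in> A}"
  let ?L = "\<lambda>n. ereal (1 / real n) * ext_log (?p n)"
  show "liminf ?L \<le> limsup ?L" by (rule Liminf_le_Limsup) simp
  have "- rate x \<le> liminf ?L" if x: "x \<in> interior A" for x
  proof (cases "rate x < \<infinity>")
    case True
    obtain d where d: "d > 0" "ball x d \<subseteq> interior A"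
      using x by (meson openE open_interior)
    \<comment> \<open>The shift \<open>(1 - t) * \<bar>x\<bar>\<close> is at most
      \<open>d * \<bar>x\<bar> / (2 * (\<bar>x\<bar> + 1))\<close>, hence below \<open>d\<close>,
      also for \<open>x = 0\<close>.\<close>
    define t where "t = max 0 (1 - d / (2 * (\<bar>x\<bar> + 1)))"
    have t: "0 \<le> t" "t < 1" using d by (auto simp: t_def)
    have "(1 - t) * \<bar>x\<bar> \<le> d / (2 * (\<bar>x\<bar> + 1)) * \<bar>x\<bar>"
      by (intro mult_right_mono) (auto simp: t_def)
    also have "\<dots> < d"
      using d by (simp add: field_simps add_strict_increasing add_pos_nonneg)
    finally have "t * x \<in> ball x d"
      using t abs_mult[of "1 - t" x] by (simp add: dist_real_def algebra_simps)
    then have tx: "t * x \<in> interior A" using d by blast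
    obtain \<theta> where \<theta>: "(\<Lambda> has_real_derivative t * x) (at \<theta>)"
      using exposed[OF True t] by blast
    have "ereal (\<theta> * (t * x) - \<Lambda> \<theta>) \<le> rate x"
      using rate_scale[OF nonneg t(1), of x] t unfolding rate_def[of "t * x"] by (simp add: SUP_le_iff)
    then have "- rate x \<le> ereal (\<Lambda> \<theta> - \<theta> * (t * x))"
      by (metis ereal_minus_le_minus minus_diff_eq uminus_ereal.simps(1))
    also have "\<dots> \<le> liminf ?L"
    proof (rule ereal_le_epsilon2)
      fix e :: real assume "0 < e"
      from exposed_point_lower_bound[OF \<theta> open_interior tx this interior_subset A]
        eventually_gt_at_top[of 0]
      have "\<forall>\<^sub>F n in sequentially. ereal (\<Lambda> \<theta> - \<theta> * (t * x) - e) \<le> ?L n"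
        by eventually_elim (rule scaled_ext_log_ge)
      then have "ereal (\<Lambda> \<theta> - \<theta> * (t * x) - e) \<le> liminf ?L"
        by (rule Liminf_bounded)
      then have "ereal (\<Lambda> \<theta> - \<theta> * (t * x) - e) + ereal e \<le> liminf ?L + ereal e"
        by (rule add_right_mono)
      then show "ereal (\<Lambda> \<theta> - \<theta> * (t * x)) \<le> liminf ?L + ereal e"
        by simp
    qed
    finally show ?thesis .
  qed simp
  then have "- liminf ?L \<le> (INF x\<in>interior A. rate x)"
    by (intro INF_greatest) (simp add: ereal_uminus_le_reorder)
  then show "- (INF x\<in>interior A. rate x) \<le> liminf ?L"
    by (simp add: ereal_uminus_le_reorder)
  have upper: "limsup ?L \<le> - ereal r" if r: "ereal r < (INF x\<in>closure A. rate x)" for r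
  proof -
    \<comment> \<open>The room between \<open>r\<close> and \<open>r'\<close> absorbs the factor 2
      of the closed-set bound.\<close>
    obtain r' where r': "ereal r < ereal r'" "ereal r' < (INF x\<in>closure A. rate x)"
      using ereal_dense2[OF r] by blast
    have "ereal r' < rate y" if "y \<in> closure A" for y
      using r'(2) INF_lower[OF that, of rate] by (rule less_le_trans)
    from closed_set_upper_bound[OF nonneg closed_closure this]
    have "\<forall>\<^sub>F n in sequentially. prob {\<omega> \<in> space M. S n \<omega> / n \<in> closure A} \<le> 2 * exp (- (n * r'))"
      by blast
    moreover have "\<forall>\<^sub>F n in sequentially. exp (- (real n * (r' - r))) \<le> 1 / 2"
      using r' by (intro eventually_exp_neg_le) auto
    ultimately have "\<forall>\<^sub>F n in sequentially. ?L n \<le> - ereal r"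
      using eventually_gt_at_top[of 0]
    proof eventually_elim
      case (elim n)
      have "?p n \<le> prob {\<omega> \<in> space M. S n \<omega> / n \<in> closure A}"
        using closure_subset[of A] by (intro finite_measure_mono) (auto, measurable)
      also have "\<dots> \<le> 2 * exp (- (n * r'))" by fact
      also have "\<dots> = 2 * (exp (- (n * (r' - r))) * exp (- (n * r)))"
        by (simp add: exp_add[symmetric] algebra_simps)
      also have "\<dots> \<le> 2 * (1 / 2 * exp (- (n * r)))"
        using elim by (intro mult_left_mono mult_right_mono) auto
      finally show ?case
        using elim by (intro scaled_ext_log_le) auto
    qed
    then show ?thesis by (rule Limsup_bounded)
  qed
  have "(INF x\<in>closure A. rate x) \<le> - limsup ?L"
  proof (rule dense_le)
    fix z assume z: "z < (INF x\<in>closure A. rate x)"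
    show "z \<le> - limsup ?L"
    proof (cases z)
      case (real r)
      then have "- (- ereal r) \<le> - limsup ?L"
        using upper[of r] z unfolding ereal_minus_le_minus by simp
      then show ?thesis using real by simp
    qed (use z in auto)
  qed
  then have "- (- limsup ?L) \<le> - (INF x\<in>closure A. rate x)"
    unfolding ereal_minus_le_minus .
  then show "limsup ?L \<le> - (INF x\<in>closure A. rate x)"
    by simp
qed

end

subsection \<open>The arcsine law\<close>

lemma integral_cos_period: "integral {0..1} (\<lambda>u. cos (2 * pi * u)) = 0"
proof -
  have "((\<lambda>u. cos (2 * pi * u)) has_integral sin (2 * pi * 1) / (2 * pi) - sin (2 * pi * 0) / (2 * pi)) {0..1}"
    by (rule fundamental_theorem_of_calculus)
      (auto intro!: derivative_eq_intros simp flip: has_real_derivative_iff_has_vector_derivative)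
  then show ?thesis by (simp add: integral_unique)
qed

text \<open>The inequality \<open>1 + s \<le> exp s\<close> is integrated, and the cosine has mean 0
  over a period.\<close>

lemma tilde_Lambda_nonneg: "tilde_Lambda \<theta> \<ge> 0"
proof -
  have "integral {0..1} (\<lambda>u. 1 + \<theta> * cos (2 * pi * u)) \<le> integral {0..1} (\<lambda>u. exp (\<theta> * cos (2 * pi * u)))"
    by (intro integral_le integrable_continuous_real continuous_intros) auto
  moreover have "integral {0..1} (\<lambda>u. 1 + \<theta> * cos (2 * pi * u)) = 1"
    by (subst Henstock_Kurzweil_Integration.integral_add)
      (auto intro!: integrable_continuous_real continuous_intros simp: integral_cos_period)
  ultimately show ?thesis
    by (simp add: tilde_Lambda_eq)
qed

lemma tilde_Lambda_le: "tilde_Lambda \<theta> \<le> \<bar>\<theta>\<bar>"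
proof -
  have "\<theta> * cos v \<le> \<bar>\<theta>\<bar>" for v
    using mult_left_mono[of "\<bar>cos v\<bar>" 1 "\<bar>\<theta>\<bar>"] abs_ge_self[of "\<theta> * cos v"] by (simp add: abs_mult)
  then have "integral {0..1} (\<lambda>u. exp (\<theta> * cos (2 * pi * u))) \<le> integral {0..1::real} (\<lambda>u. exp \<bar>\<theta>\<bar>)"
    by (intro integral_le integrable_continuous_real continuous_intros) auto
  then have "ln (integral {0..1} (\<lambda>u. exp (\<theta> * cos (2 * pi * u)))) \<le> ln (exp \<bar>\<theta>\<bar>)"
    by (intro ln_mono integral_exp_pos continuous_intros) auto
  then show ?thesis
    by (simp add: tilde_Lambda_eq)
qed

text \<open>Around a maximiser of the exponent there is an interval of length \<open>d\<close>,
  independent of \<theta>, on which the integrand is at least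
  \<open>exp (c * \<bar>\<theta>\<bar>)\<close>.\<close>

lemma tilde_Lambda_coercive:
  assumes c: "0 \<le> c" "c < 1"
  obtains d where "0 < d" "d < 1" "\<And>\<theta>. c * \<bar>\<theta>\<bar> + ln d \<le> tilde_Lambda \<theta>"
proof
  \<comment> \<open>The exponent \<open>\<theta> * cos (2 * pi * u)\<close> has Lipschitz constant
    \<open>2 * pi * \<bar>\<theta>\<bar>\<close>, so over length \<open>d\<close> it drops by at
    most \<open>(1 - c) * \<bar>\<theta>\<bar>\<close>.\<close>
  define d where "d = (1 - c) / (2 * pi)"
  show d: "0 < d" "d < 1"
    using c pi_gt3 by (auto simp: d_def field_simps)
  have d2: "d \<le> 1 / 2"
    using c pi_gt3 by (auto simp: d_def field_simps)
  fix \<theta> :: real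
  define u0 where "u0 = (if \<theta> \<ge> 0 then 0 else 1 / 2 :: real)"
  have u0: "\<theta> * cos (2 * pi * u0) = \<bar>\<theta>\<bar>" "0 \<le> u0" "u0 + d \<le> 1"
    using d d2 by (auto simp: u0_def)
  have near: "c * \<bar>\<theta>\<bar> \<le> \<theta> * cos (2 * pi * u)" if u: "u \<in> {u0..u0 + d}" for u
  proof -
    have "\<bar>cos (2 * pi * u0) - cos (2 * pi * u)\<bar> \<le> 2 * pi * \<bar>u0 - u\<bar>"
      using abs_cos_diff_le[of "2 * pi * u0" "2 * pi * u"]
      by (simp add: right_diff_distrib[symmetric] abs_mult)
    also have "\<dots> \<le> 2 * pi * d"
      using u by (intro mult_left_mono) auto
    also have "\<dots> = 1 - c" by (simp add: d_def)
    finally have "\<bar>\<theta>\<bar> * \<bar>cos (2 * pi * u0) - cos (2 * pi * u)\<bar> \<le> \<bar>\<theta>\<bar> * (1 - c)"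
      by (intro mult_left_mono) auto
    then have "\<theta> * cos (2 * pi * u0) - \<theta> * cos (2 * pi * u) \<le> \<bar>\<theta>\<bar> * (1 - c)"
      unfolding abs_mult[symmetric] right_diff_distrib by linarith
    then show ?thesis
      using u0(1) by (simp add: algebra_simps)
  qed
  have cont: "continuous_on A (\<lambda>u. exp (\<theta> * cos (2 * pi * u)))" for A
    by (intro continuous_intros)
  have "integral {u0..u0 + d} (\<lambda>u. exp (c * \<bar>\<theta>\<bar>)) \<le> integral {u0..u0 + d} (\<lambda>u. exp (\<theta> * cos (2 * pi * u)))"
    by (intro integral_le integrable_continuous_real continuous_intros) (use near in auto)
  also have "\<dots> \<le> integral {0..1} (\<lambda>u. exp (\<theta> * cos (2 * pi * u)))"
    using u0 by (intro integral_subset_le integrable_continuous_real cont) auto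
  finally have "d * exp (c * \<bar>\<theta>\<bar>) \<le> integral {0..1} (\<lambda>u. exp (\<theta> * cos (2 * pi * u)))"
    using d by simp
  then have "ln (d * exp (c * \<bar>\<theta>\<bar>)) \<le> tilde_Lambda \<theta>"
    unfolding tilde_Lambda_eq using d by (intro ln_mono) auto
  then show "c * \<bar>\<theta>\<bar> + ln d \<le> tilde_Lambda \<theta>"
    using d by (simp add: ln_mult)
qed

lemma tilde_Lambda_differentiable: "\<exists>D. (tilde_Lambda has_real_derivative D) (at \<theta>)"
proof -
  let ?\<phi> = "\<lambda>\<theta>. integral (cbox 0 1) (\<lambda>u. exp (\<theta> * cos (2 * pi * u)))"
  have "(?\<phi> has_real_derivative integral (cbox 0 1) (\<lambda>u. cos (2 * pi * u) * exp (\<theta> * cos (2 * pi * u))))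
      (at \<theta> within UNIV)"
  proof (rule leibniz_rule_field_derivative)
    show "((\<lambda>\<theta>. exp (\<theta> * cos (2 * pi * u))) has_real_derivative
        cos (2 * pi * u) * exp (\<theta> * cos (2 * pi * u))) (at \<theta> within UNIV)" for u \<theta>
      by (auto intro!: derivative_eq_intros)
    show "(\<lambda>u. exp (\<theta> * cos (2 * pi * u))) integrable_on cbox 0 1" for \<theta>
      by (intro integrable_continuous continuous_intros)
    show "continuous_on (UNIV \<times> cbox 0 1) (\<lambda>(\<theta>, u). cos (2 * pi * u) * exp (\<theta> * cos (2 * pi * u)))"
      unfolding split_beta by (intro continuous_intros)
  qed auto
  moreover have "?\<phi> \<theta> > 0"
    using integral_exp_pos[of "\<lambda>u. \<theta> * cos (2 * pi * u)"] by (simp add: continuous_intros)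
  ultimately have "((\<lambda>\<theta>. ln (?\<phi> \<theta>)) has_real_derivative inverse (?\<phi> \<theta>)
      * integral (cbox 0 1) (\<lambda>u. cos (2 * pi * u) * exp (\<theta> * cos (2 * pi * u)))) (at \<theta>)"
    by (intro DERIV_chain2[where f = ln] DERIV_ln)
  then show ?thesis
    by (auto simp: tilde_Lambda_eq[abs_def])
qed

text \<open>The slope \<open>y\<close> is attained at a global minimiser of
  \<open>tilde_Lambda \<theta> - \<theta> * y\<close>. Coercivity with a constant \<open>c\<close>
  strictly between \<open>\<bar>y\<bar>\<close> and 1 guarantees that it exists.\<close>

lemma tilde_Lambda_slope:
  assumes y: "\<bar>y\<bar> < 1"
  shows "\<exists>\<theta>. (tilde_Lambda has_real_derivative y) (at \<theta>)"
proof -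
  define g where "g \<theta> = tilde_Lambda \<theta> - \<theta> * y" for \<theta>
  define c where "c = (1 + \<bar>y\<bar>) / 2"
  have c: "0 \<le> c" "c < 1" "\<bar>y\<bar> < c" using y by (auto simp: c_def)
  obtain d where d: "0 < d" "d < 1" "\<And>\<theta>. c * \<bar>\<theta>\<bar> + ln d \<le> tilde_Lambda \<theta>"
    using tilde_Lambda_coercive[OF c(1,2)] by blast
  \<comment> \<open>At \<open>\<bar>\<theta>\<bar> = R\<close> the lower bound
    \<open>c * \<bar>\<theta>\<bar> + ln d\<close> equals
    \<open>\<bar>y\<bar> * \<bar>\<theta>\<bar>\<close>; beyond it \<open>g\<close> is positive,
    whereas \<open>g 0 = 0\<close>.\<close>
  define R where "R = - ln d / (c - \<bar>y\<bar>)"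
  have R: "R \<ge> 0" using d c by (simp add: R_def divide_nonpos_pos)
  have g0: "g 0 = 0" by (simp add: g_def tilde_Lambda_eq)
  have far: "g \<theta> > 0" if "\<bar>\<theta>\<bar> > R" for \<theta>
  proof -
    have "- ln d < (c - \<bar>y\<bar>) * \<bar>\<theta>\<bar>"
      using that c by (simp add: R_def field_simps)
    moreover have "\<theta> * y \<le> \<bar>y\<bar> * \<bar>\<theta>\<bar>"
      by (metis abs_ge_self abs_mult mult.commute)
    ultimately show ?thesis
      using d(3)[of \<theta>] unfolding g_def left_diff_distrib by linarith
  qed
  have diff: "\<exists>D. (g has_real_derivative D - y) (at \<theta>)" for \<theta>
    using tilde_Lambda_differentiable[of \<theta>] unfolding g_def
    by (auto intro!: derivative_eq_intros)
  then have "continuous_on {-R..R} g"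
    by (meson DERIV_isCont continuous_at_imp_continuous_on)
  then obtain \<theta>0 where \<theta>0: "\<theta>0 \<in> {-R..R}" "\<And>\<theta>. \<theta> \<in> {-R..R} \<Longrightarrow> g \<theta>0 \<le> g \<theta>"
    using continuous_attains_inf[of "{-R..R}" g] R by auto
  have "g \<theta>0 \<le> g \<theta>" for \<theta>
    using \<theta>0(2)[of \<theta>] \<theta>0(2)[of 0] far[of \<theta>] g0 R by (cases "\<bar>\<theta>\<bar> \<le> R") force+
  then have "D = 0" if "(g has_real_derivative D) (at \<theta>0)" for D
    using DERIV_local_min[OF that zero_less_one] by blast
  then have "(g has_real_derivative 0) (at \<theta>0)"
    using diff[of \<theta>0] by metis
  then have "((\<lambda>\<theta>. g \<theta> + \<theta> * y) has_real_derivative y) (at \<theta>0)"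
    by (auto intro!: derivative_eq_intros)
  then show ?thesis
    by (auto simp: g_def)
qed

lemma tilde_I_finite_imp: 
  assumes "tilde_I x < \<infinity>"
  shows "\<bar>x\<bar> \<le> 1"
proof (rule ccontr)
  assume x: "\<not> \<bar>x\<bar> \<le> 1"
  have "tilde_I x = \<infinity>"
    unfolding tilde_I_def
  proof (rule SUP_PInfty)
    fix n :: nat
    \<comment> \<open>As \<open>tilde_Lambda \<theta> \<le> \<bar>\<theta>\<bar>\<close>, the term
      at \<theta> is at least \<open>\<bar>\<theta>\<bar> * (\<bar>x\<bar> - 1)\<close>, which this
      choice makes equal to \<open>n\<close>.\<close>
    define \<theta> where "\<theta> = sgn x * (n / (\<bar>x\<bar> - 1))"
    have "\<bar>\<theta>\<bar> = n / (\<bar>x\<bar> - 1)" "\<theta> * x = \<bar>\<theta>\<bar> * \<bar>x\<bar>"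
      using x by (auto simp: \<theta>_def abs_mult sgn_if)
    then have "real n = \<theta> * x - \<bar>\<theta>\<bar>"
      using x by (simp add: field_simps)
    then have "ereal (real n) \<le> ereal (\<theta> * x - tilde_Lambda \<theta>)"
      using tilde_Lambda_le[of \<theta>] by simp
    then show "\<exists>\<theta>\<in>UNIV. ereal (real n) \<le> ereal (\<theta> * x - tilde_Lambda \<theta>)"
      by blast
  qed
  then show False using assms by simp
qed

section \<open>Application to lacunary cosine sums\<close>

theorem theoremA:
  fixes M :: "'a measure" and U :: "'a \<Rightarrow> real" and a :: "nat \<Rightarrow> nat"
  assumes "prob_space M"
    and "distributed M lborel U (indicator {0..1})"
    and "\<And>k. k \<ge> 1 \<Longrightarrow> a k > 0"
    and "filterlim (\<lambda>k. real (a (k + 1)) / real (a k)) at_top sequentially"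
  shows "prob_space.satisfies_LDP M
           (\<lambda>n \<omega>. (\<Sum>k=1..n. cos (2 * pi * real (a k) * U \<omega>)) / real n)
           (\<lambda>n. real n) tilde_I"
proof -
  interpret prob_space M by fact
  have U [measurable]: "random_variable borel U"
    using distributed_measurable[OF assms(2)] by simp
  define S where "S n \<omega> = (\<Sum>k=1..n. cos (2 * pi * real (a k) * U \<omega>))" for n \<omega>
  have expectation_U: "expectation (\<lambda>\<omega>. g (U \<omega>)) = integral {0..1} g"
    if g: "continuous_on UNIV g" for g :: "real \<Rightarrow> real"
  proof -
    have "expectation (\<lambda>\<omega>. g (U \<omega>)) = (LINT u : {0..1} | lborel. g u)"
      using distributed_integral[of M lborel U "indicator {0..1}" g] assms(2)
        borel_measurable_continuous_onI[OF g]
      by (simp add: ennreal_indicator set_lebesgue_integral_def)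
    then show ?thesis
      using set_borel_integral_eq_integral(2)[OF borel_integrable_atLeastAtMost'[OF continuous_on_subset[OF g]]]
      by simp
  qed
  interpret scaled_cgf M S tilde_Lambda
  proof
    show S [measurable]: "random_variable borel (S n)" for n
      unfolding S_def by measurable
    show "integrable M (\<lambda>\<omega>. exp (\<theta> * S n \<omega>))" for n \<theta>
    proof (rule integrable_const_bound)
      have "\<bar>S n \<omega>\<bar> \<le> real n" for \<omega>
        using sum_norm_bound[of "{1..n}" "\<lambda>k. cos (2 * pi * real (a k) * U \<omega>)" 1] by (simp add: S_def)
      then have "\<theta> * S n \<omega> \<le> \<bar>\<theta>\<bar> * n" for \<omega>
        using mult_left_mono[of "\<bar>S n \<omega>\<bar>" n "\<bar>\<theta>\<bar>"] abs_ge_self[of "\<theta> * S n \<omega>"]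
        by (simp add: abs_mult)
      then show "AE \<omega> in M. norm (exp (\<theta> * S n \<omega>)) \<le> exp (\<bar>\<theta>\<bar> * n)"
        by simp
    qed measurable
    show "(\<lambda>n. ln (expectation (\<lambda>\<omega>. exp (\<theta> * S n \<omega>))) / n) \<longlonglongrightarrow> tilde_Lambda \<theta>" for \<theta>
    proof -
      have "expectation (\<lambda>\<omega>. exp (\<theta> * S n \<omega>))
          = integral {0..1} (\<lambda>u. exp (\<theta> * (\<Sum>k=1..n. cos (2 * pi * a k * u))))" for n
        unfolding S_def by (intro expectation_U continuous_intros)
      then show ?thesis
        using lacunary_log_mgf_limit[OF assms(3,4), of \<theta>] by simp
    qed
  qed
  have rate: "rate = tilde_I"
    by (simp add: rate_def tilde_I_def fun_eq_iff)
  show ?thesis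
    unfolding S_def[symmetric] rate[symmetric]
  proof (rule gaertner_ellis)
    \<comment> \<open>Finite rate confines \<open>x\<close> to [-1, 1], and the factor
      \<open>t < 1\<close> moves it into the open interval of attained slopes.\<close>
    fix x t :: real assume "rate x < \<infinity>" and t: "0 \<le> t" "t < 1"
    then have "\<bar>x\<bar> \<le> 1" using tilde_I_finite_imp rate by simp
    then have "\<bar>t * x\<bar> < 1"
      using t mult_left_mono[of "\<bar>x\<bar>" 1 t] by (simp add: abs_mult)
    then show "\<exists>\<theta>. (tilde_Lambda has_real_derivative t * x) (at \<theta>)"
      by (rule tilde_Lambda_slope)
  qed (rule tilde_Lambda_nonneg)
qed

end
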